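(* There is an absolute constant $C>0$ such that the following holds. Let $\delta > 0$ and let $n$ be an integer with $n \geq \delta^{-2}$. Let $G$ be a graph on vertex set $[n]=\{1,\dots,n\}$ and let $(d_1,\dots,d_n)$ be a realizable sequence such that $$\sum_{i=1}^{n} |d_G(i) - d_i| \leq \delta n^2 .$$ Then there is a graph $G'$ on vertex set $[n]$ such that $|E(G') \triangle E(G)| \leq C\delta^{1/2} n^2$ and $d_{G'}(i) = d_i$ for every $i \in [n]$.
   Context: Graphs are finite, simple and undirected. $d_G(i)$ denotes the degree of vertex $i$ in $G$. A sequence $(d_1,\dots,d_n)$ of non-negative integers is realizable (graphic) if there is a graph $H$ on vertex set $[n]$ with $d_H(i)=d_i$ for all $i\in[n]$. $\triangle$ denotes symmetric difference. *)

theory Defs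
  imports Main Complex_Main
begin

definition is_graph_on :: "nat \<Rightarrow> nat set set \<Rightarrow> bool" where
  "is_graph_on n E \<longleftrightarrow> (\<forall>e\<in>E. e \<subseteq> {1..n} \<and> card e = 2)"

definition deg :: "nat set set \<Rightarrow> nat \<Rightarrow> nat" where
  "deg E i = card {e\<in>E. i \<in> e}"

definition realizable :: "nat \<Rightarrow> (nat \<Rightarrow> nat) \<Rightarrow> bool" where
  "realizable n d \<longleftrightarrow> (\<exists>H. is_graph_on n H \<and> (\<forall>i\<in>{1..n}. deg H i = d i))"

end

theory Submission
  imports Defs "HOL-Library.Disjoint_Sets" "HOL-Library.Z2"
begin

text \<open>
  View \<open>G\<close> and a realization \<open>H\<close> of \<open>d\<close> as symmetric digraphs, and let \<open>M\<close> have the in- and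
  out-degrees of \<open>H\<close> and be as close to \<open>G\<close> as switching allows. An alternating closed walk in the
  symmetric difference could be switched to get closer to \<open>G\<close>, so the residual digraph on two copies
  of the vertex set, with an arc from the tail copy to the head copy for every arc of \<open>M - G\<close> and in
  the opposite direction for every arc of \<open>G - M\<close>, is acyclic. Weigh an arc by the difference of the
  positions of its ends in a topological order. The total weight of the symmetric difference is at
  most the number \<open>2n\<close> of positions times the total deviation of the in- and out-degrees, while only
  \<open>n (2t + 1)\<close> arcs have weight at most \<open>t\<close>; taking \<open>t = \<delta>\<^bsup>1/2\<^esup> n\<close> bounds the number of arcs.

  To make \<open>M\<close> symmetric, note that its unreciprocated arcs form a balanced digraph. Along an even
  closed trail these arcs can alternately be reciprocated and deleted without changing degrees;
  along an odd closed trail this creates a surplus or a deficit (as we like) of one at the initial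
  vertex. As the degree sum is even, odd trails come in pairs, and toggling the edge between the two
  initial vertices compensates. The cost is at most twice the number of unreciprocated arcs, which
  is at most the distance from \<open>M\<close> to \<open>G\<close>.
\<close>


section \<open>In- and out-degrees\<close>

definition outdeg :: "('a \<times> 'b) set \<Rightarrow> 'a \<Rightarrow> nat" where
  "outdeg R x = card (R `` {x})"

abbreviation indeg :: "('a \<times> 'b) set \<Rightarrow> 'b \<Rightarrow> nat" where
  "indeg R \<equiv> outdeg (R\<inverse>)"

definition balanced :: "'a rel \<Rightarrow> bool" where
  "balanced R \<longleftrightarrow> outdeg R = indeg R"

lemma balancedD: "balanced R \<Longrightarrow> indeg R x = outdeg R x"
  by (simp add: balanced_def)

lemma sym_imp_balanced: "sym R \<Longrightarrow> balanced R"
  by (simp add: balanced_def sym_conv_converse_eq)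

lemma outdeg_empty [simp]: "outdeg {} x = 0"
  by (simp add: outdeg_def)

lemma outdeg_Un_disjoint:
  assumes "finite A" "finite B" "A \<inter> B = {}"
  shows "outdeg (A \<union> B) x = outdeg A x + outdeg B x"
proof -
  have "A `` {x} \<inter> B `` {x} = {}"
    using assms(3) by auto
  then show ?thesis
    using assms by (simp add: outdeg_def Un_Image card_Un_disjoint)
qed

lemma outdeg_insert:
  assumes "finite R" "(u, v) \<notin> R"
  shows "outdeg (insert (u, v) R) x = outdeg R x + of_bool (x = u)"
proof -
  have "outdeg {(u, v)} x = of_bool (x = u)"
    by (auto simp: outdeg_def Image_def)
  then show ?thesis
    using outdeg_Un_disjoint[of "{(u, v)}" R x] assms by simp
qed

lemma indeg_insert:
  assumes "finite R" "(u, v) \<notin> R"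
  shows "indeg (insert (u, v) R) x = indeg R x + of_bool (x = v)"
proof -
  have "(insert (u, v) R)\<inverse> = insert (v, u) (R\<inverse>)" by auto
  then show ?thesis using outdeg_insert[of "R\<inverse>" v u x] assms by simp
qed

lemma outdeg_mono:
  assumes "finite B" "A \<subseteq> B"
  shows "outdeg A x \<le> outdeg B x"
  unfolding outdeg_def using assms by (intro card_mono finite_Image) auto

lemma outdeg_gt_0_iff: "finite R \<Longrightarrow> outdeg R x > 0 \<longleftrightarrow> x \<in> Domain R"
  by (auto simp: outdeg_def card_gt_0_iff)

lemma Domain_eq_if_outdeg_eq:
  "finite R \<Longrightarrow> finite S \<Longrightarrow> outdeg R = outdeg S \<Longrightarrow> Domain R = Domain S"
  by (auto simp: set_eq_iff simp flip: outdeg_gt_0_iff)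

lemma balanced_Field: "finite R \<Longrightarrow> balanced R \<Longrightarrow> Field R = Domain R"
  using Domain_eq_if_outdeg_eq[of R "R\<inverse>"] by (simp add: Field_def balanced_def)

lemma outdeg_exchange:
  assumes "finite M" "finite Q" "R \<subseteq> M" "Q \<inter> M = {}"
  shows "outdeg ((M - R) \<union> Q) x + outdeg R x = outdeg M x + outdeg Q x"
proof -
  have fin: "finite R" using assms by (auto intro: finite_subset)
  have "outdeg ((M - R) \<union> Q) x = outdeg (M - R) x + outdeg Q x"
    using assms by (intro outdeg_Un_disjoint) auto
  moreover have "outdeg ((M - R) \<union> R) x = outdeg (M - R) x + outdeg R x"
    using assms fin by (intro outdeg_Un_disjoint) auto
  moreover have "(M - R) \<union> R = M" using assms(3) by auto
  ultimately show ?thesis by simp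
qed

lemma indeg_exchange:
  assumes "finite M" "finite Q" "R \<subseteq> M" "Q \<inter> M = {}"
  shows "indeg ((M - R) \<union> Q) x + indeg R x = indeg M x + indeg Q x"
proof -
  have "((M - R) \<union> Q)\<inverse> = (M\<inverse> - R\<inverse>) \<union> Q\<inverse>" by auto
  then show ?thesis using outdeg_exchange[of "M\<inverse>" "Q\<inverse>" "R\<inverse>" x] assms by auto
qed

lemma outdeg_Diff:
  assumes "finite B" "A \<subseteq> B"
  shows "outdeg (B - A) x + outdeg A x = outdeg B x"
  using outdeg_exchange[of B "{}" A x] assms by simp

lemma balanced_Diff:
  assumes "finite S" "balanced S" "T \<subseteq> S" "balanced T"
  shows "balanced (S - T)"
  unfolding balanced_def
proof
  fix x
  show "outdeg (S - T) x = indeg (S - T) x"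
    using outdeg_exchange[of S "{}" T x] indeg_exchange[of S "{}" T x] assms
    by (simp add: balancedD)
qed

lemma sum_fst_eq_sum_outdeg:
  fixes f :: "'a \<Rightarrow> 'c::comm_semiring_1"
  assumes "finite V" "finite R" "R \<subseteq> V \<times> W"
  shows "(\<Sum>e\<in>R. f (fst e)) = (\<Sum>x\<in>V. f x * of_nat (outdeg R x))"
proof -
  have "R = Sigma V (\<lambda>x. R `` {x})" using assms(3) by auto
  then have "(\<Sum>e\<in>R. f (fst e)) = (\<Sum>(x, y)\<in>Sigma V (\<lambda>x. R `` {x}). f x)"
    by (simp add: case_prod_unfold)
  also have "\<dots> = (\<Sum>x\<in>V. \<Sum>y\<in>R `` {x}. f x)"
    using assms by (subst sum.Sigma) auto
  finally show ?thesis by (simp add: outdeg_def mult.commute)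
qed

lemma sum_snd_eq_sum_indeg:
  fixes f :: "'b \<Rightarrow> 'c::comm_semiring_1"
  assumes "finite W" "finite R" "R \<subseteq> V \<times> W"
  shows "(\<Sum>e\<in>R. f (snd e)) = (\<Sum>y\<in>W. f y * of_nat (indeg R y))"
proof -
  have "(\<Sum>e\<in>R. f (snd e)) = (\<Sum>e\<in>R\<inverse>. f (fst e))"
    by (rule sum.reindex_bij_witness[of _ prod.swap prod.swap]) auto
  also have "\<dots> = (\<Sum>y\<in>W. f y * of_nat (indeg R y))"
    using assms by (intro sum_fst_eq_sum_outdeg[where W = V]) auto
  finally show ?thesis .
qed

lemma card_eq_sum_outdeg:
  assumes "finite V" "finite R" "R \<subseteq> V \<times> W"
  shows "card R = (\<Sum>x\<in>V. outdeg R x)"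
  using sum_fst_eq_sum_outdeg[OF assms, of "\<lambda>_. 1::nat"] by simp

lemma card_eq_if_outdeg_eq:
  fixes R S :: "('a \<times> 'b) set"
  assumes "finite R" "finite S" "outdeg R = outdeg S"
  shows "card R = card S"
proof -
  let ?V = "Domain R \<union> Domain S"
  have "card R = (\<Sum>x\<in>?V. outdeg R x)" "card S = (\<Sum>x\<in>?V. outdeg S x)"
    using assms(1,2) by (auto intro!: card_eq_sum_outdeg[where W = UNIV] simp: finite_Domain)
  then show ?thesis using assms(3) by simp
qed

lemma even_card_sym_irrefl:
  assumes "sym R" "irrefl R"
  shows "even (card R)"
proof -
  have swap: "prod.swap e \<in> R" "prod.swap e \<noteq> e" if "e \<in> R" for e
    using that assms by (cases e; auto simp: sym_def irrefl_def)+
  have "(\<Sum>e\<in>R. 1 :: bit) = 0"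
    by (rule sum_involution_eq_0[where h = prod.swap]) (simp_all add: swap)
  then have "of_nat (card R) = (0::bit)" by simp
  then show ?thesis by (metis even_of_nat even_zero)
qed


section \<open>Closed trails in balanced digraphs\<close>

inductive trail :: "'a \<Rightarrow> 'a \<Rightarrow> 'a rel \<Rightarrow> bool" where
  trail_nil: "trail u u {}"
| trail_cons: "trail v w T \<Longrightarrow> (u, v) \<notin> T \<Longrightarrow> trail u w (insert (u, v) T)"

lemma trail_finite: "trail u w T \<Longrightarrow> finite T"
  by (induction rule: trail.induct) auto

lemma trail_single: "trail u v {(u, v)}"
  using trail_cons[OF trail_nil] by fastforce

lemma trail_append:
  "trail u v T \<Longrightarrow> trail v w T' \<Longrightarrow> T \<inter> T' = {} \<Longrightarrow> trail u w (T \<union> T')"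
proof (induction rule: trail.induct)
  case (trail_cons y w' T u)
  then show ?case using trail.trail_cons[of y w "T \<union> T'" u] by auto
qed simp

lemma trail_split:
  assumes "trail u w T" "x \<in> Field T"
  obtains T1 T2 where "T = T1 \<union> T2" "T1 \<inter> T2 = {}" "trail u x T1" "trail x w T2"
  using assms
proof (induction arbitrary: thesis rule: trail.induct)
  case (trail_cons v w T u)
  have whole: "trail u w (insert (u, v) T)"
    using trail_cons.hyps by (rule trail.trail_cons)
  consider "x = u" | "x = v" | "x \<in> Field T"
    using trail_cons.prems(2) by (auto simp: Field_def)
  then show ?case
  proof cases
    assume "x = u"
    then show ?thesis
      by (intro trail_cons.prems(1)[of "{}" "insert (u, v) T"]) (use whole trail_nil in auto)
  next
    assume "x = v"
    then show ?thesis
      by (intro trail_cons.prems(1)[of "{(u, v)}" T]) (use trail_cons.hyps trail_single in auto)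
  next
    assume "x \<in> Field T"
    then obtain T1 T2 where T: "T = T1 \<union> T2" "T1 \<inter> T2 = {}" "trail v x T1" "trail x w T2"
      using trail_cons.IH by blast
    show ?thesis
      by (intro trail_cons.prems(1)[of "insert (u, v) T1" T2])
        (use T trail_cons.hyps(2) in \<open>auto intro: trail.trail_cons\<close>)
  qed
qed simp

lemma trail_splice:
  assumes "trail u v T" "trail w w T'" "w \<in> Field T" "T \<inter> T' = {}"
  shows "trail u v (T \<union> T')"
proof -
  obtain T1 T2 where split: "T = T1 \<union> T2" "T1 \<inter> T2 = {}" "trail u w T1" "trail w v T2"
    using trail_split[OF assms(1,3)] .
  have "trail w v (T' \<union> T2)" using trail_append[OF assms(2) split(4)] assms(4) split(1) by blast
  then have "trail u v (T1 \<union> (T' \<union> T2))"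
    using trail_append[OF split(3)] assms(4) split(1,2) by blast
  moreover have "T1 \<union> (T' \<union> T2) = T \<union> T'" using split(1) by blast
  ultimately show ?thesis by simp
qed

lemma trail_start_in_Field: "trail u w T \<Longrightarrow> T \<noteq> {} \<Longrightarrow> u \<in> Field T"
  by (cases rule: trail.cases) (auto simp: Field_def)

lemma trail_outdeg_indeg:
  "trail u w T \<Longrightarrow> outdeg T x + of_bool (x = w) = indeg T x + of_bool (x = u)"
proof (induction rule: trail.induct)
  case (trail_cons v w T u)
  then show ?case
    using outdeg_insert[of T u v x] indeg_insert[of T u v x] trail_finite by fastforce
qed simp

lemma closed_trail_balanced: "trail u u T \<Longrightarrow> balanced T"
  using trail_outdeg_indeg[of u u T] by (simp add: balanced_def fun_eq_iff)

lemma balanced_ex_closed_trail: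
  assumes fin: "finite S" and bal: "balanced S" and "u \<in> Domain S"
  obtains T where "T \<noteq> {}" "T \<subseteq> S" "trail u u T"
proof -
  let ?F = "{T. T \<subseteq> S \<and> (\<exists>w. trail u w T)}"
  obtain v where "{(u, v)} \<in> ?F" using assms(3) trail_single by fastforce
  moreover have "finite ?F" using fin by simp
  ultimately obtain T where T: "T \<in> ?F" "(u, v) \<in> T"
    and maximal: "\<And>T'. T' \<in> ?F \<Longrightarrow> T \<subseteq> T' \<Longrightarrow> T = T'"
    using finite_has_maximal2[of ?F "{(u, v)}"] by auto
  then obtain w where w: "trail u w T" "T \<subseteq> S" by blast
  have "w = u"
  proof (rule ccontr)
    assume "w \<noteq> u"
    then have "outdeg T w < indeg T w" using trail_outdeg_indeg[OF w(1), of w] by simp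
    also have "\<dots> \<le> indeg S w" using w(2) fin by (intro outdeg_mono) auto
    also have "\<dots> = outdeg S w" using bal by (rule balancedD)
    finally have "outdeg (S - T) w > 0" using outdeg_Diff[OF fin w(2), of w] by simp
    then obtain z where z: "(w, z) \<in> S" "(w, z) \<notin> T" using fin by (auto simp: outdeg_gt_0_iff)
    then have "T \<union> {(w, z)} \<in> ?F"
      using w trail_append[OF w(1) trail_single[of w z]] by auto
    from maximal[OF this] show False using z by blast
  qed
  with T(2) w that show ?thesis by blast
qed

lemma balanced_ex_isolated_closed_trail:
  assumes fin: "finite S" and bal: "balanced S" and ne: "S \<noteq> {}"
  obtains u T where "T \<noteq> {}" "T \<subseteq> S" "trail u u T" "Field T \<inter> Field (S - T) = {}"
proof -
  let ?F = "{T. T \<noteq> {} \<and> T \<subseteq> S \<and> (\<exists>u. trail u u T)}"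
  have "finite ?F" using fin by simp
  have "?F \<noteq> {}"
  proof -
    obtain u where "u \<in> Domain S" using ne by auto
    with fin bal obtain T where "T \<noteq> {}" "T \<subseteq> S" "trail u u T"
      by (rule balanced_ex_closed_trail)
    then show ?thesis by auto
  qed
  with \<open>finite ?F\<close> have "\<exists>T\<in>?F. \<forall>T'\<in>?F. T \<subseteq> T' \<longrightarrow> T = T'"
    by (rule finite_has_maximal)
  then obtain T where "T \<in> ?F" and maximal: "\<forall>T'\<in>?F. T \<subseteq> T' \<longrightarrow> T = T'"
    by (rule bexE)
  from \<open>T \<in> ?F\<close> obtain u where T: "T \<noteq> {}" "T \<subseteq> S" "trail u u T" by blast
  have "Field T \<inter> Field (S - T) = {}"
  proof (rule ccontr)
    assume "Field T \<inter> Field (S - T) \<noteq> {}"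
    then obtain w where w: "w \<in> Field T" "w \<in> Field (S - T)" by blast
    have bal': "balanced (S - T)"
      using balanced_Diff[OF fin bal T(2) closed_trail_balanced[OF T(3)]] .
    have "w \<in> Domain (S - T)" using w(2) balanced_Field[OF _ bal'] fin by simp
    then obtain T' where T': "T' \<noteq> {}" "T' \<subseteq> S - T" "trail w w T'"
      using balanced_ex_closed_trail[OF _ bal'] fin by blast
    have "trail u u (T \<union> T')" using trail_splice[OF T(3) T'(3) w(1)] T'(2) by blast
    then have "T \<union> T' \<in> ?F" using T T' by auto
    from maximal[rule_format, OF this Un_upper1] show False using T'(1,2) by blast
  qed
  from that[OF T this] show ?thesis .
qed

text \<open>The sets \<open>A\<close> and \<open>B\<close> consist of the arcs at alternating positions of the trail,
  with the first arc in \<open>A\<close>.\<close>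

lemma trail_alternating:
  assumes "trail u w T"
  obtains A B where "A \<union> B = T" "A \<inter> B = {}"
    "\<And>x. outdeg A x + of_bool (even (card T) \<and> x = w) = indeg B x + of_bool (x = u)"
    "\<And>x. indeg A x = outdeg B x + of_bool (odd (card T) \<and> x = w)"
  using assms
proof (induction arbitrary: thesis rule: trail.induct)
  case (trail_nil u)
  show ?case by (rule trail_nil[of "{}" "{}"]) auto
next
  case (trail_cons v w T u)
  obtain A B where AB: "A \<union> B = T" "A \<inter> B = {}"
    "\<And>x. outdeg A x + of_bool (even (card T) \<and> x = w) = indeg B x + of_bool (x = v)"
    "\<And>x. indeg A x = outdeg B x + of_bool (odd (card T) \<and> x = w)"
    using trail_cons.IH by blast
  have fin: "finite T" using trail_cons.hyps(1) by (rule trail_finite)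
  then have B: "finite B" "(u, v) \<notin> B" using AB(1) trail_cons.hyps(2) by auto
  have card: "card (insert (u, v) T) = Suc (card T)" using fin trail_cons.hyps(2) by simp
  show ?case
  proof (rule trail_cons.prems[of "insert (u, v) B" A])
    show "insert (u, v) B \<union> A = insert (u, v) T" using AB(1) by auto
    show "insert (u, v) B \<inter> A = {}" using AB(1,2) trail_cons.hyps(2) by auto
    show "outdeg (insert (u, v) B) x + of_bool (even (card (insert (u, v) T)) \<and> x = w)
        = indeg A x + of_bool (x = u)" for x
      using AB(4)[of x] by (simp add: card outdeg_insert[OF B])
    show "indeg (insert (u, v) B) x
        = outdeg A x + of_bool (odd (card (insert (u, v) T)) \<and> x = w)" for x
      using AB(3)[of x] by (simp add: card indeg_insert[OF B])
  qed
qed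


section \<open>Symmetrising a balanced digraph\<close>

definition unreciprocated :: "'a rel \<Rightarrow> 'a rel" where
  "unreciprocated M = M - M\<inverse>"

lemma unreciprocated_subset: "unreciprocated M \<subseteq> M"
  by (auto simp: unreciprocated_def)

lemma balanced_unreciprocated:
  assumes "finite M" "balanced M"
  shows "balanced (unreciprocated M)"
proof -
  have "unreciprocated M = M - (M \<inter> M\<inverse>)" by (auto simp: unreciprocated_def)
  moreover have "balanced (M \<inter> M\<inverse>)" by (intro sym_imp_balanced) (auto simp: sym_def)
  ultimately show ?thesis using balanced_Diff[OF assms, of "M \<inter> M\<inverse>"] by simp
qed

lemma even_card_unreciprocated:
  assumes "finite M" "irrefl M"
  shows "even (card (unreciprocated M)) \<longleftrightarrow> even (card M)"
proof -
  have "even (card (M \<inter> M\<inverse>))"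
    using assms(2) by (intro even_card_sym_irrefl) (auto simp: sym_def irrefl_def)
  moreover have "card M = card (M \<inter> M\<inverse>) + card (unreciprocated M)"
    unfolding unreciprocated_def using assms(1) by (rule card_Int_Diff)
  ultimately show ?thesis by simp
qed

lemma card_unreciprocated_le_sym_diff:
  assumes "finite M" "finite G" "sym G"
  shows "card (unreciprocated M) \<le> card (sym_diff M G)"
proof -
  define f where "f a = (if a \<in> G then prod.swap a else a)" for a :: "'a \<times> 'a"
  have "inj_on f (unreciprocated M)"
    unfolding f_def unreciprocated_def by (rule inj_onI) (auto split: if_splits)
  moreover have "f ` unreciprocated M \<subseteq> sym_diff M G"
    using assms(3) unfolding f_def unreciprocated_def by (auto dest: symD)
  ultimately show ?thesis using assms by (meson card_inj_on_le finite_Diff finite_UnI)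
qed

lemma card_sym_diff_triangle:
  assumes "finite A" "finite B" "finite C"
  shows "card (sym_diff A C) \<le> card (sym_diff A B) + card (sym_diff B C)"
proof -
  have "card (sym_diff A C) \<le> card (sym_diff A B \<union> sym_diff B C)"
    using assms by (intro card_mono) auto
  then show ?thesis using card_Un_le order_trans by blast
qed

definition degree_shift :: "'a rel \<Rightarrow> 'a rel \<Rightarrow> ('a \<Rightarrow> int) \<Rightarrow> bool" where
  "degree_shift M M' f \<longleftrightarrow> (\<forall>x. int (outdeg M' x) = int (outdeg M x) + f x \<and>
     int (indeg M' x) = int (indeg M x) + f x)"

lemma degree_shift_trans:
  "degree_shift M M' f \<Longrightarrow> degree_shift M' M'' g \<Longrightarrow> degree_shift M M'' (\<lambda>x. f x + g x)"
  by (auto simp: degree_shift_def)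

lemma degree_shift_0_iff:
  "degree_shift M M' (\<lambda>x. 0) \<longleftrightarrow> outdeg M' = outdeg M \<and> indeg M' = indeg M"
  by (auto simp: degree_shift_def fun_eq_iff)

definition rounding :: "'a rel \<Rightarrow> 'a rel \<Rightarrow> 'a rel \<Rightarrow> 'a rel" where
  "rounding M A B = (M - B) \<union> A\<inverse>"

lemma
  assumes "A \<subseteq> unreciprocated M" "B \<subseteq> unreciprocated M" "A \<inter> B = {}"
  shows unreciprocated_rounding:
      "unreciprocated (rounding M A B) = unreciprocated M - (A \<union> B)"
    and sym_diff_rounding: "sym_diff (rounding M A B) M = A\<inverse> \<union> B"
  using assms unfolding rounding_def unreciprocated_def by (safe; blast)+

lemma rounding_degree_shift:
  assumes "finite M" "A \<subseteq> unreciprocated M" "B \<subseteq> unreciprocated M"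
    and "\<And>x. int (indeg A x) = int (outdeg B x) + f x"
    and "\<And>x. int (outdeg A x) = int (indeg B x) + f x"
  shows "degree_shift M (rounding M A B) f"
  unfolding degree_shift_def
proof
  fix x
  have "finite (A\<inverse>)" "B \<subseteq> M" "A\<inverse> \<inter> M = {}"
    using assms(1-3) by (auto simp: unreciprocated_def intro: finite_subset)
  from outdeg_exchange[OF assms(1) this, of x] indeg_exchange[OF assms(1) this, of x]
  show "int (outdeg (rounding M A B) x) = int (outdeg M x) + f x \<and>
      int (indeg (rounding M A B) x) = int (indeg M x) + f x"
    using assms(4,5)[of x] by (simp add: rounding_def)
qed

lemma closed_trail_alternating:
  fixes \<sigma> :: int
  assumes "trail u u T" "\<sigma> \<in> {1, -1}"
  obtains A B where "A \<union> B = T" "A \<inter> B = {}"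
    "\<And>x. int (indeg A x) = int (outdeg B x) + \<sigma> * of_bool (odd (card T) \<and> x = u)"
    "\<And>x. int (outdeg A x) = int (indeg B x) + \<sigma> * of_bool (odd (card T) \<and> x = u)"
proof -
  obtain A B where AB: "A \<union> B = T" "A \<inter> B = {}"
    "\<And>x. outdeg A x + of_bool (even (card T) \<and> x = u) = indeg B x + of_bool (x = u)"
    "\<And>x. indeg A x = outdeg B x + of_bool (odd (card T) \<and> x = u)"
    using trail_alternating[OF assms(1)] by blast
  have outdeg: "outdeg A x = indeg B x + of_bool (odd (card T) \<and> x = u)" for x
    using AB(3)[of x] by (auto split: if_splits)
  consider "\<sigma> = 1" | "\<sigma> = -1" using assms(2) by blast
  then show ?thesis
  proof cases
    assume "\<sigma> = 1"
    then show ?thesis using AB(1,2,4) outdeg by (intro that[of A B]) auto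
  next
    assume "\<sigma> = -1"
    then show ?thesis using AB(1,2,4) outdeg by (intro that[of B A]) auto
  qed
qed

lemma round_closed_trail:
  fixes \<sigma> :: int
  assumes "finite M" "irrefl M" "T \<subseteq> unreciprocated M" "trail u u T" "\<sigma> \<in> {1, -1}"
  obtains M' where "finite M'" "irrefl M'" "unreciprocated M' = unreciprocated M - T"
    "card (sym_diff M' M) \<le> card T"
    "degree_shift M M' (\<lambda>x. \<sigma> * of_bool (odd (card T) \<and> x = u))"
proof -
  obtain A B where AB: "A \<union> B = T" "A \<inter> B = {}"
    and alternating:
      "\<And>x. int (indeg A x) = int (outdeg B x) + \<sigma> * of_bool (odd (card T) \<and> x = u)"
      "\<And>x. int (outdeg A x) = int (indeg B x) + \<sigma> * of_bool (odd (card T) \<and> x = u)"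
    using closed_trail_alternating[OF assms(4,5)] by blast
  have sub: "A \<subseteq> unreciprocated M" "B \<subseteq> unreciprocated M" using AB(1) assms(3) by auto
  have fin: "finite A" "finite B" using AB(1) trail_finite[OF assms(4)] by auto
  let ?M = "rounding M A B"
  show ?thesis
  proof (rule that[of ?M])
    show "finite ?M" using assms(1) fin by (simp add: rounding_def)
    show "irrefl ?M"
      using assms(2) sub by (auto simp: rounding_def irrefl_def unreciprocated_def)
    show "unreciprocated ?M = unreciprocated M - T"
      unfolding unreciprocated_rounding[OF sub AB(2)] AB(1) ..
    have "card (sym_diff ?M M) \<le> card (A\<inverse>) + card B"
      unfolding sym_diff_rounding[OF sub AB(2)] by (rule card_Un_le)
    also have "\<dots> = card T" using card_Un_disjoint[OF fin AB(2)] AB(1) by simp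
    finally show "card (sym_diff ?M M) \<le> card T" .
    show "degree_shift M ?M (\<lambda>x. \<sigma> * of_bool (odd (card T) \<and> x = u))"
      using rounding_degree_shift[OF assms(1) sub alternating] .
  qed
qed

lemma degree_shift_Un_sym:
  assumes "finite M" "finite Q" "sym Q" "Q \<inter> M = {}"
  shows "degree_shift M (M \<union> Q) (\<lambda>x. int (outdeg Q x))"
  using outdeg_exchange[of M Q "{}"] indeg_exchange[of M Q "{}"] assms
  by (simp add: degree_shift_def sym_conv_converse_eq)

lemma degree_shift_Diff_sym:
  assumes "finite M" "sym Q" "Q \<subseteq> M"
  shows "degree_shift M (M - Q) (\<lambda>x. - int (outdeg Q x))"
proof -
  have "outdeg M x = outdeg (M - Q) x + outdeg Q x" "indeg M x = indeg (M - Q) x + outdeg Q x" for x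
    using outdeg_exchange[of M "{}" Q x] indeg_exchange[of M "{}" Q x] assms
    by (simp_all add: sym_conv_converse_eq)
  then show ?thesis by (simp add: degree_shift_def)
qed

lemma toggle_edge:
  assumes "finite M" "irrefl M" "u \<noteq> v" "(u, v) \<in> M \<longleftrightarrow> (v, u) \<in> M"
  obtains \<sigma> :: int and M' where "\<sigma> \<in> {1, -1}" "finite M'" "irrefl M'"
    "unreciprocated M' = unreciprocated M" "card (sym_diff M' M) = 2"
    "degree_shift M M' (\<lambda>x. \<sigma> * (of_bool (x = u) + of_bool (x = v)))"
proof -
  define Q where "Q = {(u, v), (v, u)}"
  define \<sigma> :: int where "\<sigma> = (if (u, v) \<in> M then -1 else 1)"
  have Q: "finite Q" "sym Q" "card Q = 2" using assms(3) by (auto simp: Q_def sym_def)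
  have outdeg_Q: "outdeg Q x = of_bool (x = u) + of_bool (x = v)" for x
    using assms(3) by (simp add: Q_def outdeg_insert)
  have "degree_shift M (sym_diff M Q) (\<lambda>x. \<sigma> * int (outdeg Q x))"
  proof (cases "(u, v) \<in> M")
    case True
    then have "Q \<subseteq> M" using assms(4) by (simp add: Q_def)
    moreover from this have "sym_diff M Q = M - Q" by auto
    ultimately show ?thesis
      using degree_shift_Diff_sym[of M Q] assms(1) Q(2) True by (simp add: \<sigma>_def)
  next
    case False
    then have "Q \<inter> M = {}" using assms(4) by (simp add: Q_def)
    moreover from this have "sym_diff M Q = M \<union> Q" by auto
    ultimately show ?thesis
      using degree_shift_Un_sym[of M Q] assms(1) Q(1,2) False by (simp add: \<sigma>_def)
  qed
  then have "degree_shift M (sym_diff M Q) (\<lambda>x. \<sigma> * (of_bool (x = u) + of_bool (x = v)))"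
    by (simp add: outdeg_Q)
  moreover have "sym_diff (sym_diff M Q) M = Q" by auto
  moreover have "irrefl (sym_diff M Q)"
    using assms(2,3) by (auto simp: irrefl_def Q_def)
  moreover have "unreciprocated (sym_diff M Q) = unreciprocated M"
    using assms(4) by (auto simp: unreciprocated_def Q_def)
  ultimately show ?thesis
    using that[of \<sigma> "sym_diff M Q"] assms(1) Q by (simp add: \<sigma>_def)
qed

lemma round_odd_trail_pair:
  assumes M: "finite M" "irrefl M"
    and T: "T \<subseteq> unreciprocated M" "trail u u T" "odd (card T)"
    and T': "T' \<subseteq> unreciprocated M - T" "trail v v T'" "odd (card T')"
    and uv: "u \<noteq> v" "(u, v) \<in> M \<longleftrightarrow> (v, u) \<in> M"
  obtains M' where "finite M'" "irrefl M'" "outdeg M' = outdeg M" "indeg M' = indeg M"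
    "unreciprocated M' = unreciprocated M - T - T'"
    "card (sym_diff M' M) \<le> card T + card T' + 2"
proof -
  obtain \<sigma> M1 where \<sigma>: "\<sigma> \<in> {1, -1 :: int}" and M1: "finite M1" "irrefl M1"
      "unreciprocated M1 = unreciprocated M" "card (sym_diff M1 M) = 2"
      "degree_shift M M1 (\<lambda>x. \<sigma> * (of_bool (x = u) + of_bool (x = v)))"
    using toggle_edge[OF M uv] .
  have \<sigma>': "- \<sigma> \<in> {1, -1}" using \<sigma> by auto
  have "T \<subseteq> unreciprocated M1" using T(1) M1(3) by simp
  then obtain M2 where M2: "finite M2" "irrefl M2"
      "unreciprocated M2 = unreciprocated M1 - T" "card (sym_diff M2 M1) \<le> card T"
      "degree_shift M1 M2 (\<lambda>x. - \<sigma> * of_bool (odd (card T) \<and> x = u))"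
    using round_closed_trail[OF M1(1,2) _ T(2) \<sigma>'] by blast
  have "T' \<subseteq> unreciprocated M2" using T'(1) M1(3) M2(3) by simp
  then obtain M3 where M3: "finite M3" "irrefl M3"
      "unreciprocated M3 = unreciprocated M2 - T'" "card (sym_diff M3 M2) \<le> card T'"
      "degree_shift M2 M3 (\<lambda>x. - \<sigma> * of_bool (odd (card T') \<and> x = v))"
    using round_closed_trail[OF M2(1,2) _ T'(2) \<sigma>'] by blast
  have "degree_shift M M3 (\<lambda>x. 0)"
    using degree_shift_trans[OF degree_shift_trans[OF M1(5) M2(5)] M3(5)] T(3) T'(3)
    by (simp add: algebra_simps)
  moreover have "card (sym_diff M3 M) \<le> card T + card T' + 2"
    using card_sym_diff_triangle[of M3 M2 M] card_sym_diff_triangle[of M2 M1 M]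
      M(1) M1(1,4) M2(1,4) M3(1,4) by linarith
  ultimately show ?thesis
    using that[of M3] M1(3) M2(3) M3(1-3) by (simp add: degree_shift_0_iff)
qed

text \<open>An odd trail that is a whole component of \<open>S\<close> is disjoint from any second odd trail, and
  no arc of \<open>S\<close> joins the two.\<close>

lemma balanced_even_trail_or_odd_trail_pair [consumes 4]:
  assumes S: "finite S" "balanced S" "S \<noteq> {}" "even (card S)"
  obtains
    (even_trail) u T where "T \<noteq> {}" "T \<subseteq> S" "trail u u T" "even (card T)"
  | (odd_pair) u T v T' where "T \<subseteq> S" "trail u u T" "odd (card T)"
      "T' \<subseteq> S - T" "trail v v T'" "odd (card T')" "u \<noteq> v" "(u, v) \<notin> S" "(v, u) \<notin> S"
proof -
  obtain u T where T: "T \<noteq> {}" "T \<subseteq> S" "trail u u T" "Field T \<inter> Field (S - T) = {}"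
    using balanced_ex_isolated_closed_trail[OF S(1-3)] .
  show ?thesis
  proof (cases "even (card T)")
    case True
    with T show ?thesis by (intro even_trail)
  next
    case odd_T: False
    with S(4) have "T \<noteq> S" by blast
    with T(2) obtain v where v: "v \<in> Domain (S - T)" by auto
    have "balanced (S - T)"
      using balanced_Diff[OF S(1,2) T(2) closed_trail_balanced[OF T(3)]] .
    then obtain T' where T': "T' \<noteq> {}" "T' \<subseteq> S - T" "trail v v T'"
      using balanced_ex_closed_trail[OF _ _ v] S(1) by blast
    show ?thesis
    proof (cases "even (card T')")
      case True
      with T' show ?thesis by (intro even_trail[of T' v]) auto
    next
      case odd_T': False
      have "u \<in> Field T" "v \<in> Field (S - T)"
        using trail_start_in_Field[OF T(3,1)] v by (auto simp: Field_def)
      then have "u \<noteq> v" "(u, v) \<notin> S" "(v, u) \<notin> S"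
        using T(4) by (blast intro: FieldI1 FieldI2)+
      with T(2,3) T'(2,3) odd_T odd_T' show ?thesis by (intro odd_pair)
    qed
  qed
qed

lemma symmetrise_step:
  assumes M: "finite M" "irrefl M" "balanced M" "even (card M)"
    and ne: "unreciprocated M \<noteq> {}"
  obtains M' where "finite M'" "irrefl M'" "outdeg M' = outdeg M" "indeg M' = indeg M"
    "unreciprocated M' \<subset> unreciprocated M"
    "card (sym_diff M' M) + 2 * card (unreciprocated M') \<le> 2 * card (unreciprocated M)"
proof -
  let ?S = "unreciprocated M"
  have S: "finite ?S" "balanced ?S" "even (card ?S)"
    using finite_subset[OF unreciprocated_subset M(1)] balanced_unreciprocated[OF M(1,3)]
      even_card_unreciprocated[OF M(1,2)] M(4) by simp_all
  from S(1,2) ne S(3) show ?thesis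
  proof (cases rule: balanced_even_trail_or_odd_trail_pair)
    case (even_trail u T)
    obtain M' where M': "finite M'" "irrefl M'" "unreciprocated M' = ?S - T"
        "card (sym_diff M' M) \<le> card T"
        "degree_shift M M' (\<lambda>x. 1 * of_bool (odd (card T) \<and> x = u))"
      using round_closed_trail[OF M(1,2) even_trail(2,3), of 1] by blast
    then have degrees: "outdeg M' = outdeg M" "indeg M' = indeg M"
      using even_trail(4) by (simp_all add: degree_shift_0_iff)
    show ?thesis
    proof (rule that[OF M'(1,2) degrees])
      show "unreciprocated M' \<subset> ?S" using M'(3) even_trail(1,2) by blast
      show "card (sym_diff M' M) + 2 * card (unreciprocated M') \<le> 2 * card ?S"
        using M'(3,4) card_Int_Diff[OF S(1), of T] even_trail(2) by (simp add: Int_absorb1)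
    qed
  next
    case (odd_pair u T v T')
    have "(u, v) \<in> M \<longleftrightarrow> (v, u) \<in> M" using odd_pair(8,9) by (auto simp: unreciprocated_def)
    then obtain M' where M': "finite M'" "irrefl M'" "outdeg M' = outdeg M" "indeg M' = indeg M"
        "unreciprocated M' = ?S - T - T'" "card (sym_diff M' M) \<le> card T + card T' + 2"
      using round_odd_trail_pair[OF M(1,2) odd_pair(1-7)] by blast
    have "card ?S = card (?S - T - T') + card T + card T'"
      using card_Int_Diff[of ?S T] card_Int_Diff[of "?S - T" T'] S(1) odd_pair(1,4)
      by (simp add: Int_absorb1)
    moreover have "card T > 0" "card T' > 0" using odd_pair(3,6) by (auto intro: odd_pos)
    ultimately have "card (sym_diff M' M) + 2 * card (unreciprocated M') \<le> 2 * card ?S"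
      using M'(5,6) by simp
    moreover have "T \<noteq> {}" using odd_pair(3) by auto
    then have "unreciprocated M' \<subset> ?S" using M'(5) odd_pair(1) by blast
    ultimately show ?thesis using that[OF M'(1-4)] by blast
  qed
qed

lemma symmetrise:
  assumes "finite M" "irrefl M" "balanced M" "even (card M)"
  obtains M' where "finite M'" "irrefl M'" "sym M'" "outdeg M' = outdeg M"
    "card (sym_diff M' M) \<le> 2 * card (unreciprocated M)"
  using assms
proof (induction "card (unreciprocated M)" arbitrary: M thesis rule: less_induct)
  case less
  show ?case
  proof (cases "unreciprocated M = {}")
    case True
    then have "sym M" by (auto simp: sym_def unreciprocated_def)
    with less.prems show ?thesis by (intro less.prems(1)[of M]) auto
  next
    case False
    obtain M1 where M1: "finite M1" "irrefl M1" "outdeg M1 = outdeg M" "indeg M1 = indeg M"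
        "unreciprocated M1 \<subset> unreciprocated M"
        "card (sym_diff M1 M) + 2 * card (unreciprocated M1) \<le> 2 * card (unreciprocated M)"
      using symmetrise_step[OF less.prems(2-5) False] .
    have "card (unreciprocated M1) < card (unreciprocated M)"
      using M1(5) less.prems(2) finite_subset[OF unreciprocated_subset]
      by (intro psubset_card_mono) auto
    moreover have "balanced M1" using M1(3,4) less.prems(4) by (simp add: balanced_def)
    moreover have "even (card M1)"
      using card_eq_if_outdeg_eq[OF M1(1) less.prems(2) M1(3)] less.prems(5) by simp
    ultimately obtain M' where M': "finite M'" "irrefl M'" "sym M'" "outdeg M' = outdeg M1"
        "card (sym_diff M' M1) \<le> 2 * card (unreciprocated M1)"
      using less.hyps[of M1] M1(1,2) by blast
    have "card (sym_diff M' M) \<le> 2 * card (unreciprocated M)"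
      using card_sym_diff_triangle[OF M'(1) M1(1) less.prems(2)] M'(5) M1(6) by linarith
    with M' M1(3) show ?thesis by (intro less.prems(1)[of M']) auto
  qed
qed


section \<open>Residual digraphs and potentials\<close>

definition residual :: "('a \<times> 'b) set \<Rightarrow> ('a \<times> 'b) set \<Rightarrow> ('a + 'b) rel" where
  "residual R Q = (\<lambda>(u, v). (Inl u, Inr v)) ` R \<union> (\<lambda>(u, v). (Inr v, Inl u)) ` Q"

lemma in_residual_iff [simp]:
  "(Inl u, y) \<in> residual R Q \<longleftrightarrow> y \<in> Inr ` (R `` {u})"
  "(Inr v, y) \<in> residual R Q \<longleftrightarrow> y \<in> Inl ` (Q\<inverse> `` {v})"
  by (force simp: residual_def)+

lemma residual_subset:
  "R \<subseteq> V \<times> W \<Longrightarrow> Q \<subseteq> V \<times> W \<Longrightarrow> residual R Q \<subseteq> (V <+> W) \<times> (V <+> W)"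
  by (auto simp: residual_def)

lemma finite_residual: "finite R \<Longrightarrow> finite Q \<Longrightarrow> finite (residual R Q)"
  by (simp add: residual_def)

lemma subset_residualE:
  assumes "C \<subseteq> residual R Q"
  obtains R' Q' where "R' \<subseteq> R" "Q' \<subseteq> Q" "C = residual R' Q'"
proof
  let ?R = "{(u, v). (Inl u, Inr v) \<in> C}" and ?Q = "{(u, v). (Inr v, Inl u) \<in> C}"
  show "?R \<subseteq> R" "?Q \<subseteq> Q" by (auto dest!: subsetD[OF assms])
  show "C = residual ?R ?Q"
  proof (rule set_eqI)
    fix e
    show "e \<in> C \<longleftrightarrow> e \<in> residual ?R ?Q"
      using subsetD[OF assms, of e] by (cases e; cases "fst e"; cases "snd e"; auto)
  qed
qed

lemma outdeg_residual:
  "outdeg (residual R Q) (Inl u) = outdeg R u"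
  "outdeg (residual R Q) (Inr v) = indeg Q v"
proof -
  have "residual R Q `` {Inl u} = Inr ` (R `` {u})" "residual R Q `` {Inr v} = Inl ` (Q\<inverse> `` {v})"
    by auto
  then show "outdeg (residual R Q) (Inl u) = outdeg R u"
    "outdeg (residual R Q) (Inr v) = indeg Q v"
    by (simp_all add: outdeg_def card_image)
qed

lemma converse_residual: "(residual R Q)\<inverse> = residual Q R"
  by (simp add: residual_def converse_Un) (auto simp: image_iff)

lemma balanced_residual_iff:
  "balanced (residual R Q) \<longleftrightarrow> outdeg R = outdeg Q \<and> indeg R = indeg Q"
  by (auto simp: balanced_def converse_residual fun_eq_iff split_sum_all outdeg_residual)

lemma finite_self_map_bij:
  assumes "finite X" "X \<noteq> {}" "f ` X \<subseteq> X"
  obtains Y where "Y \<subseteq> X" "Y \<noteq> {}" "bij_betw f Y Y"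
proof -
  let ?F = "{Y. Y \<subseteq> X \<and> Y \<noteq> {} \<and> f ` Y \<subseteq> Y}"
  have "finite ?F" "?F \<noteq> {}" using assms by auto
  then have "\<exists>Y\<in>?F. \<forall>Z\<in>?F. Z \<subseteq> Y \<longrightarrow> Y = Z" by (rule finite_has_minimal)
  then obtain Y where Y: "Y \<in> ?F" and minimal: "\<forall>Z\<in>?F. Z \<subseteq> Y \<longrightarrow> Y = Z" by (rule bexE)
  have "f ` Y \<in> ?F" "f ` Y \<subseteq> Y" using Y by auto
  then have "Y = f ` Y" using minimal by simp
  moreover have "finite Y" using Y assms(1) by (auto intro: finite_subset)
  ultimately have "bij_betw f Y Y" using finite_surj_inj[of Y f] by (auto simp: bij_betw_def)
  with Y show ?thesis using that by blast
qed

lemma not_acyclic_ex_balanced_subset: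
  assumes "finite D" "\<not> acyclic D"
  obtains C where "C \<noteq> {}" "C \<subseteq> D" "balanced C"
proof -
  have "\<not> wf (D\<inverse>)" using assms(2) wf_acyclic acyclic_converse by blast
  then obtain X where X: "X \<noteq> {}" "\<forall>x\<in>X. \<exists>y\<in>X. (x, y) \<in> D"
    unfolding wf_eq_minimal by (metis converseD empty_iff)
  then obtain f where f: "\<And>x. x \<in> X \<Longrightarrow> f x \<in> X \<and> (x, f x) \<in> D" by metis
  have "X \<subseteq> Domain D" using X(2) by auto
  then have "finite X" using assms(1) by (auto simp: finite_Domain intro: finite_subset)
  then obtain Y where Y: "Y \<subseteq> X" "Y \<noteq> {}" "bij_betw f Y Y"
    using finite_self_map_bij[of X f] X(1) f by blast
  define C where "C = (\<lambda>x. (x, f x)) ` Y"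
  have "outdeg C x = of_bool (x \<in> Y)" for x
  proof -
    have "C `` {x} = (if x \<in> Y then {f x} else {})" by (auto simp: C_def)
    then show ?thesis by (simp add: outdeg_def)
  qed
  moreover have "indeg C y = of_bool (y \<in> Y)" for y
  proof -
    have "C\<inverse> `` {y} = (if y \<in> Y then {inv_into Y f y} else {})"
      using Y(3) by (auto simp: C_def bij_betw_def inv_into_into f_inv_into_f image_iff)
    then show ?thesis by (simp add: outdeg_def)
  qed
  ultimately have "balanced C" by (simp add: balanced_def fun_eq_iff)
  moreover have "C \<noteq> {}" "C \<subseteq> D" using Y(1,2) f by (auto simp: C_def)
  ultimately show ?thesis using that by blast
qed

lemma switch_residual_cycle:
  assumes "finite M" "finite G" "\<not> acyclic (residual (M - G) (G - M))"
  obtains M' where "outdeg M' = outdeg M" "indeg M' = indeg M" "sym_diff M' G \<subset> sym_diff M G"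
proof -
  obtain C where C: "C \<noteq> {}" "C \<subseteq> residual (M - G) (G - M)" "balanced C"
    using not_acyclic_ex_balanced_subset[OF finite_residual assms(3)] assms(1,2) by blast
  from C(2) obtain R Q where RQ: "R \<subseteq> M - G" "Q \<subseteq> G - M" "C = residual R Q"
    by (rule subset_residualE)
  then have degrees: "outdeg R = outdeg Q" "indeg R = indeg Q"
    using C(3) by (simp_all add: balanced_residual_iff)
  have sub: "finite Q" "R \<subseteq> M" "Q \<inter> M = {}"
    using RQ(1,2) finite_subset[OF RQ(2)] assms(2) by auto
  show ?thesis
  proof (rule that)
    show "outdeg ((M - R) \<union> Q) = outdeg M"
      using outdeg_exchange[OF assms(1) sub] degrees(1) by (auto simp: fun_eq_iff)
    show "indeg ((M - R) \<union> Q) = indeg M"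
      using indeg_exchange[OF assms(1) sub] degrees(2) by (auto simp: fun_eq_iff)
    have "R \<union> Q \<noteq> {}" using C(1) RQ(3) by (auto simp: residual_def)
    then show "sym_diff ((M - R) \<union> Q) G \<subset> sym_diff M G" using RQ(1,2) by blast
  qed
qed

lemma ex_acyclic_residual:
  assumes "finite H" "finite G"
  obtains M where "outdeg M = outdeg H" "indeg M = indeg H" "sym_diff M G \<subseteq> sym_diff H G"
    "acyclic (residual (M - G) (G - M))"
  using assms(1)
proof (induction "card (sym_diff H G)" arbitrary: H thesis rule: less_induct)
  case less
  show ?case
  proof (cases "acyclic (residual (H - G) (G - H))")
    case True
    then show ?thesis by (intro less.prems(1)[of H]) auto
  next
    case False
    then obtain H' where H': "outdeg H' = outdeg H" "indeg H' = indeg H"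
        "sym_diff H' G \<subset> sym_diff H G"
      using switch_residual_cycle[OF less.prems(2) assms(2)] by blast
    have "H' \<subseteq> H \<union> G" using H'(3) by blast
    then have "finite H'" using less.prems(2) assms(2) by (auto intro: finite_subset)
    moreover have "card (sym_diff H' G) < card (sym_diff H G)"
      using H'(3) less.prems(2) assms(2) by (intro psubset_card_mono) auto
    ultimately obtain M where "outdeg M = outdeg H'" "indeg M = indeg H'"
        "sym_diff M G \<subseteq> sym_diff H' G" "acyclic (residual (M - G) (G - M))"
      using less.hyps[of H'] by blast
    with H' show ?thesis by (intro less.prems(1)[of M]) auto
  qed
qed

lemma acyclic_topological_order:
  assumes "finite V" "finite D" "acyclic D"
  obtains p where "bij_betw p V {..<card V}" "\<And>x y. x \<in> V \<Longrightarrow> y \<in> V \<Longrightarrow> (x, y) \<in> D \<Longrightarrow> p x < p y"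
  using assms(1)
proof (induction V arbitrary: thesis rule: finite_psubset_induct)
  case (psubset V)
  show ?case
  proof (cases "V = {}")
    case True
    then show ?thesis by (intro psubset.prems[of "\<lambda>_. 0"]) (auto simp: bij_betw_def)
  next
    case False
    obtain x where x: "x \<in> V" "\<And>y. (x, y) \<in> D \<Longrightarrow> y \<notin> V"
      using wfE_min'[OF finite_acyclic_wf_converse[OF assms(2,3)] False] by auto
    obtain p where p: "bij_betw p (V - {x}) {..<card (V - {x})}"
        "\<And>y z. y \<in> V - {x} \<Longrightarrow> z \<in> V - {x} \<Longrightarrow> (y, z) \<in> D \<Longrightarrow> p y < p z"
      using psubset.IH[of "V - {x}"] x(1) by blast
    define q where "q = p(x := card (V - {x}))"
    have card: "card V = Suc (card (V - {x}))" using psubset.hyps x(1) by (rule card.remove)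
    have "bij_betw q (V - {x}) {..<card (V - {x})}"
      using p(1) bij_betw_cong[of "V - {x}" q p] by (simp add: q_def)
    then have "bij_betw q ((V - {x}) \<union> {x}) ({..<card (V - {x})} \<union> {q x})"
      by (subst notIn_Un_bij_betw3[symmetric]) (auto simp: q_def)
    moreover have "(V - {x}) \<union> {x} = V" using x(1) by auto
    moreover have "{..<card (V - {x})} \<union> {q x} = {..<card V}"
      unfolding card lessThan_Suc by (auto simp: q_def)
    ultimately have "bij_betw q V {..<card V}" by simp
    moreover have "q y < q z" if yz: "y \<in> V" "z \<in> V" "(y, z) \<in> D" for y z
    proof -
      have "y \<noteq> x" using x(2) yz(2,3) by blast
      then have "p y < card (V - {x})" using bij_betwE[OF p(1)] yz(1) by blast
      then show ?thesis using p(2)[of y z] \<open>y \<noteq> x\<close> yz by (simp add: q_def)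
    qed
    ultimately show ?thesis by (rule psubset.prems)
  qed
qed

lemma acyclic_residual_potential:
  assumes fin: "finite V" "finite W" and sub: "R \<subseteq> V \<times> W" "Q \<subseteq> V \<times> W"
    and acyclic: "acyclic (residual R Q)"
  obtains a :: "'a \<Rightarrow> nat" and b :: "'b \<Rightarrow> nat"
  where "inj_on b W" "\<And>u. u \<in> V \<Longrightarrow> a u \<le> card V + card W"
    "\<And>v. v \<in> W \<Longrightarrow> b v \<le> card V + card W"
    "\<And>u v. (u, v) \<in> R \<Longrightarrow> a u < b v" "\<And>u v. (u, v) \<in> Q \<Longrightarrow> b v < a u"
proof -
  have "finite (V <+> W)" "finite (residual R Q)"
    using finite_subset[OF residual_subset[OF sub]] fin by simp_all
  then obtain p where p: "bij_betw p (V <+> W) {..<card (V <+> W)}"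
    "\<And>x y. x \<in> V <+> W \<Longrightarrow> y \<in> V <+> W \<Longrightarrow> (x, y) \<in> residual R Q \<Longrightarrow> p x < p y"
    using acyclic_topological_order[OF _ _ acyclic] by blast
  have less: "p x < card V + card W" if "x \<in> V <+> W" for x
    using bij_betwE[OF p(1)] that by (simp add: card_Plus fin)
  have mono: "p x < p y" if "(x, y) \<in> residual R Q" for x y
    using p(2)[OF _ _ that] residual_subset[OF sub] that by blast
  show ?thesis
  proof (rule that[of "p \<circ> Inr" "p \<circ> Inl"])
    show "inj_on (p \<circ> Inr) W"
      using p(1) by (auto simp: bij_betw_def inj_on_def)
    show "u \<in> V \<Longrightarrow> (p \<circ> Inl) u \<le> card V + card W" for u
      by (auto intro!: less_imp_le less)
    show "v \<in> W \<Longrightarrow> (p \<circ> Inr) v \<le> card V + card W" for v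
      by (auto intro!: less_imp_le less)
    show "(u, v) \<in> R \<Longrightarrow> (p \<circ> Inl) u < (p \<circ> Inr) v" for u v
      using mono[of "Inl u" "Inr v"] by simp
    show "(u, v) \<in> Q \<Longrightarrow> (p \<circ> Inr) v < (p \<circ> Inl) u" for u v
      using mono[of "Inr v" "Inl u"] by simp
  qed
qed


section \<open>Nearby digraphs with prescribed degrees\<close>

definition degree_dist :: "'a set \<Rightarrow> 'b set \<Rightarrow> ('a \<times> 'b) set \<Rightarrow> ('a \<times> 'b) set \<Rightarrow> real" where
  "degree_dist V W M G = (\<Sum>u\<in>V. \<bar>real (outdeg M u) - real (outdeg G u)\<bar>) +
     (\<Sum>v\<in>W. \<bar>real (indeg M v) - real (indeg G v)\<bar>)"

lemma sum_mult_diff_le: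
  fixes c f g :: "'a \<Rightarrow> real"
  assumes "\<And>x. x \<in> V \<Longrightarrow> \<bar>c x\<bar> \<le> N"
  shows "\<bar>\<Sum>x\<in>V. c x * (f x - g x)\<bar> \<le> N * (\<Sum>x\<in>V. \<bar>f x - g x\<bar>)"
proof -
  have "\<bar>\<Sum>x\<in>V. c x * (f x - g x)\<bar> \<le> (\<Sum>x\<in>V. \<bar>c x\<bar> * \<bar>f x - g x\<bar>)"
    unfolding abs_mult[symmetric] by (rule sum_abs)
  also have "\<dots> \<le> (\<Sum>x\<in>V. N * \<bar>f x - g x\<bar>)"
    using assms by (intro sum_mono mult_right_mono) auto
  finally show ?thesis by (simp add: sum_distrib_left)
qed

lemma sum_potential_diff_le:
  fixes a :: "'a \<Rightarrow> real" and b :: "'b \<Rightarrow> real"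
  assumes fin: "finite V" "finite W" and sub: "M \<subseteq> V \<times> W" "G \<subseteq> V \<times> W"
    and bounds: "\<And>u. u \<in> V \<Longrightarrow> \<bar>a u\<bar> \<le> N" "\<And>v. v \<in> W \<Longrightarrow> \<bar>b v\<bar> \<le> N"
  shows "(\<Sum>(u, v)\<in>M. b v - a u) - (\<Sum>(u, v)\<in>G. b v - a u) \<le> N * degree_dist V W M G"
proof -
  have split: "(\<Sum>(u, v)\<in>R. b v - a u) =
      (\<Sum>v\<in>W. b v * real (indeg R v)) - (\<Sum>u\<in>V. a u * real (outdeg R u))"
    if "R \<subseteq> V \<times> W" for R
  proof -
    have "finite R" using finite_subset[OF that] fin by simp
    then show ?thesis
      using sum_fst_eq_sum_outdeg[OF fin(1) _ that, of a]
        sum_snd_eq_sum_indeg[OF fin(2) _ that, of b]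
      by (simp add: case_prod_unfold sum_subtractf)
  qed
  have "(\<Sum>(u, v)\<in>M. b v - a u) - (\<Sum>(u, v)\<in>G. b v - a u) =
      (\<Sum>v\<in>W. b v * (real (indeg M v) - real (indeg G v))) -
      (\<Sum>u\<in>V. a u * (real (outdeg M u) - real (outdeg G u)))"
    unfolding split[OF sub(1)] split[OF sub(2)] by (simp add: right_diff_distrib sum_subtractf)
  also have "\<dots> \<le> N * degree_dist V W M G"
    using sum_mult_diff_le[of W b N "\<lambda>v. real (indeg M v)" "\<lambda>v. real (indeg G v)"]
      sum_mult_diff_le[of V a N "\<lambda>u. real (outdeg M u)" "\<lambda>u. real (outdeg G u)"] bounds
    by (simp add: degree_dist_def distrib_left)
  finally show ?thesis .
qed

lemma card_inj_near_le:
  fixes b :: "'a \<Rightarrow> nat" and t :: real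
  assumes "inj_on b W" "t \<ge> 0"
  shows "real (card {v\<in>W. \<bar>real (b v) - real c\<bar> \<le> t}) \<le> 2 * t + 1"
proof -
  let ?I = "{int c - \<lfloor>t\<rfloor> .. int c + \<lfloor>t\<rfloor>}"
  have "card {v\<in>W. \<bar>real (b v) - real c\<bar> \<le> t} \<le> card ?I"
  proof (rule card_inj_on_le[where f = "\<lambda>v. int (b v)"])
    show "inj_on (\<lambda>v. int (b v)) {v\<in>W. \<bar>real (b v) - real c\<bar> \<le> t}"
      using assms(1) by (auto simp: inj_on_def)
    show "(\<lambda>v. int (b v)) ` {v\<in>W. \<bar>real (b v) - real c\<bar> \<le> t} \<subseteq> ?I"
    proof clarify
      fix v assume "\<bar>real (b v) - real c\<bar> \<le> t"
      then have "int (b v) - int c \<le> \<lfloor>t\<rfloor>" "int c - int (b v) \<le> \<lfloor>t\<rfloor>"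
        by (auto simp: le_floor_iff)
      then show "int (b v) \<in> ?I" by auto
    qed
  qed simp
  moreover have "real (card ?I) = 2 * \<lfloor>t\<rfloor> + 1" using assms(2) by simp
  moreover have "real_of_int \<lfloor>t\<rfloor> \<le> t" by simp
  ultimately show ?thesis by linarith
qed

lemma card_light_arcs_le:
  fixes a :: "'a \<Rightarrow> nat" and b :: "'b \<Rightarrow> nat" and t :: real
  assumes "finite V" "finite W" "inj_on b W" "t \<ge> 0"
  shows "real (card {(u, v)\<in>V \<times> W. \<bar>real (b v) - real (a u)\<bar> \<le> t}) \<le> real (card V) * (2 * t + 1)"
proof -
  have "{(u, v)\<in>V \<times> W. \<bar>real (b v) - real (a u)\<bar> \<le> t} =
      Sigma V (\<lambda>u. {v\<in>W. \<bar>real (b v) - real (a u)\<bar> \<le> t})" by auto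
  then have "real (card {(u, v)\<in>V \<times> W. \<bar>real (b v) - real (a u)\<bar> \<le> t}) =
      (\<Sum>u\<in>V. real (card {v\<in>W. \<bar>real (b v) - real (a u)\<bar> \<le> t}))"
    using assms(1,2) by simp
  also have "\<dots> \<le> real (card V) * (2 * t + 1)"
    using card_inj_near_le[OF assms(3,4)] by (intro sum_bounded_above)
  finally show ?thesis .
qed

lemma card_gt_mult_le_sum:
  fixes f :: "'a \<Rightarrow> real"
  assumes "finite A" "\<And>x. x \<in> A \<Longrightarrow> f x \<ge> 0"
  shows "real (card {x\<in>A. f x > t}) * t \<le> sum f A"
proof -
  have "real (card {x\<in>A. f x > t}) * t = (\<Sum>x\<in>{x\<in>A. f x > t}. t)" by simp
  also have "\<dots> \<le> (\<Sum>x\<in>{x\<in>A. f x > t}. f x)" by (intro sum_mono) auto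
  also have "\<dots> \<le> sum f A" using assms by (intro sum_mono2) auto
  finally show ?thesis .
qed

lemma sum_abs_sym_diff:
  fixes w :: "'a \<Rightarrow> real"
  assumes "finite M" "finite G" "\<And>e. e \<in> M - G \<Longrightarrow> w e \<ge> 0" "\<And>e. e \<in> G - M \<Longrightarrow> w e \<le> 0"
  shows "(\<Sum>e\<in>sym_diff M G. \<bar>w e\<bar>) = sum w M - sum w G"
proof -
  have "(\<Sum>e\<in>sym_diff M G. \<bar>w e\<bar>) = (\<Sum>e\<in>M - G. \<bar>w e\<bar>) + (\<Sum>e\<in>G - M. \<bar>w e\<bar>)"
    using assms(1,2) by (intro sum.union_disjoint) auto
  also have "\<dots> = sum w (M - G) - sum w (G - M)"
    using assms(3,4) by (simp add: abs_of_nonpos sum_negf)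
  also have "\<dots> = sum w M - sum w G"
    using sum.Int_Diff[of M w G] sum.Int_Diff[of G w M] assms(1,2) by (simp add: Int_commute)
  finally show ?thesis .
qed

lemma card_sym_diff_acyclic_residual_le:
  fixes M G :: "('a \<times> 'b) set" and t :: real
  assumes fin: "finite V" "finite W" and sub: "M \<subseteq> V \<times> W" "G \<subseteq> V \<times> W"
    and acyclic: "acyclic (residual (M - G) (G - M))" and t: "t > 0"
  shows "real (card (sym_diff M G)) \<le>
    real (card V) * (2 * t + 1) + real (card V + card W) * degree_dist V W M G / t"
proof -
  have diff: "M - G \<subseteq> V \<times> W" "G - M \<subseteq> V \<times> W" using sub by auto
  obtain a :: "'a \<Rightarrow> nat" and b :: "'b \<Rightarrow> nat" where inj: "inj_on b W"
    and bounds: "\<And>u. u \<in> V \<Longrightarrow> a u \<le> card V + card W"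
      "\<And>v. v \<in> W \<Longrightarrow> b v \<le> card V + card W"
    and increasing: "\<And>u v. (u, v) \<in> M - G \<Longrightarrow> a u < b v"
      "\<And>u v. (u, v) \<in> G - M \<Longrightarrow> b v < a u"
    by (rule acyclic_residual_potential[OF fin diff acyclic]) (rule that)
  define w where "w = (\<lambda>(u, v). real (b v) - real (a u))"
  define light where "light = {(u, v)\<in>V \<times> W. \<bar>real (b v) - real (a u)\<bar> \<le> t}"
  define heavy where "heavy = {e\<in>sym_diff M G. \<bar>w e\<bar> > t}"
  have finite: "finite M" "finite G" "finite light"
    using finite_subset[OF sub(1)] finite_subset[OF sub(2)] finite_subset[of light "V \<times> W"] fin
    by (auto simp: light_def)
  have "real (card heavy) * t \<le> (\<Sum>e\<in>sym_diff M G. \<bar>w e\<bar>)"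
    unfolding heavy_def using finite by (intro card_gt_mult_le_sum) auto
  also have "\<dots> = sum w M - sum w G"
    by (intro sum_abs_sym_diff finite) (auto simp: w_def less_imp_le increasing)
  also have "\<dots> \<le> real (card V + card W) * degree_dist V W M G"
    unfolding w_def
    by (intro sum_potential_diff_le fin sub) (auto simp: bounds simp flip: of_nat_add)
  finally have "real (card heavy) \<le> real (card V + card W) * degree_dist V W M G / t"
    using t by (simp add: field_simps)
  moreover have "real (card light) \<le> real (card V) * (2 * t + 1)"
    unfolding light_def using card_light_arcs_le[OF fin inj] t by simp
  moreover have "card (sym_diff M G) \<le> card light + card heavy"
  proof -
    have "sym_diff M G \<subseteq> light \<union> heavy"
      using sub by (auto simp: light_def heavy_def w_def)
    then have "card (sym_diff M G) \<le> card (light \<union> heavy)"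
      using finite by (intro card_mono) (auto simp: heavy_def)
    then show ?thesis using card_Un_le order_trans by blast
  qed
  ultimately show ?thesis by linarith
qed

lemma ex_near_with_same_degrees:
  fixes G H :: "('a \<times> 'b) set" and t :: real
  assumes fin: "finite V" "finite W" and sub: "G \<subseteq> V \<times> W" "H \<subseteq> V \<times> W" and t: "t > 0"
  obtains M where "M \<subseteq> H \<union> G" "outdeg M = outdeg H" "indeg M = indeg H"
    "real (card (sym_diff M G)) \<le>
      real (card V) * (2 * t + 1) + real (card V + card W) * degree_dist V W H G / t"
proof -
  have "finite G" "finite H" using finite_subset[OF sub(1)] finite_subset[OF sub(2)] fin by simp_all
  then obtain M where M: "outdeg M = outdeg H" "indeg M = indeg H"
      "sym_diff M G \<subseteq> sym_diff H G" "acyclic (residual (M - G) (G - M))"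
    using ex_acyclic_residual by blast
  have "M \<subseteq> H \<union> G" using M(3) by blast
  moreover from this have "M \<subseteq> V \<times> W" using sub by blast
  moreover have "degree_dist V W M G = degree_dist V W H G"
    using M(1,2) by (simp add: degree_dist_def)
  ultimately show ?thesis
    using that[of M] M(1,2) card_sym_diff_acyclic_residual_le[OF fin _ sub(1) M(4) t] by simp
qed

lemma ex_near_balanced_digraph:
  fixes G H :: "'a rel" and t :: real
  assumes V: "finite V" and G: "G \<subseteq> V \<times> V" "sym G" and H: "H \<subseteq> V \<times> V" "sym H" and t: "t \<ge> 1"
    and deviation: "(\<Sum>x\<in>V. \<bar>real (outdeg G x) - real (outdeg H x)\<bar>) \<le> t\<^sup>2"
  obtains M where "M \<subseteq> H \<union> G" "balanced M" "outdeg M = outdeg H"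
    "real (card (sym_diff M G)) \<le> 7 * real (card V) * t"
proof -
  let ?N = "real (card V)" and ?dist = "degree_dist V V H G"
  have conv: "G\<inverse> = G" "H\<inverse> = H" using G(2) H(2) by (simp_all add: sym_conv_converse_eq)
  have t_pos: "t > 0" using t by simp
  obtain M where M: "M \<subseteq> H \<union> G" "outdeg M = outdeg H" "indeg M = indeg H"
      "real (card (sym_diff M G)) \<le> ?N * (2 * t + 1) + real (card V + card V) * ?dist / t"
    using ex_near_with_same_degrees[OF V V G(1) H(1) t_pos] by blast
  have "?dist = 2 * (\<Sum>x\<in>V. \<bar>real (outdeg G x) - real (outdeg H x)\<bar>)"
    by (simp add: degree_dist_def conv abs_minus_commute)
  then have "?dist / t \<le> 2 * t"
    using deviation t_pos by (simp add: pos_divide_le_eq power2_eq_square)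
  then have "2 * ?N * (?dist / t) \<le> 2 * ?N * (2 * t)" by (rule mult_left_mono) simp
  then have "real (card (sym_diff M G)) \<le> ?N * (6 * t + 1)"
    using M(4) by (simp add: algebra_simps)
  also have "\<dots> \<le> ?N * (7 * t)" using t by (intro mult_left_mono) auto
  finally have "real (card (sym_diff M G)) \<le> 7 * ?N * t" by simp
  moreover have "balanced M" using M(2,3) conv(2) by (simp add: balanced_def)
  ultimately show ?thesis using that[OF M(1)] M(2) by blast
qed

lemma ex_near_sym_digraph:
  fixes G H :: "'a rel" and t :: real
  assumes V: "finite V" and G: "G \<subseteq> V \<times> V" "irrefl G" "sym G"
    and H: "H \<subseteq> V \<times> V" "irrefl H" "sym H" and t: "t \<ge> 1"
    and deviation: "(\<Sum>x\<in>V. \<bar>real (outdeg G x) - real (outdeg H x)\<bar>) \<le> t\<^sup>2"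
  obtains M where "M \<subseteq> V \<times> V" "irrefl M" "sym M" "outdeg M = outdeg H"
    "real (card (sym_diff M G)) \<le> 21 * real (card V) * t"
proof -
  obtain N where N: "N \<subseteq> H \<union> G" "balanced N" "outdeg N = outdeg H"
      "real (card (sym_diff N G)) \<le> 7 * real (card V) * t"
    using ex_near_balanced_digraph[OF V G(1,3) H(1,3) t deviation] .
  have "finite (V \<times> V)" "N \<subseteq> V \<times> V" using V N(1) G(1) H(1) by auto
  then have finite: "finite G" "finite H" "finite N" using G(1) H(1) finite_subset by blast+
  have "irrefl N" using N(1) G(2) H(2) by (auto simp: irrefl_def)
  moreover have "even (card N)"
    using card_eq_if_outdeg_eq[OF finite(3,2) N(3)] even_card_sym_irrefl[OF H(3,2)] by simp
  ultimately obtain M where M: "finite M" "irrefl M" "sym M" "outdeg M = outdeg N"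
      "card (sym_diff M N) \<le> 2 * card (unreciprocated N)"
    using symmetrise[OF finite(3) _ N(2)] by blast
  have "Domain M = Domain H"
    using Domain_eq_if_outdeg_eq[OF M(1) finite(2)] M(4) N(3) by simp
  then have "Field M \<subseteq> V" using balanced_Field[OF M(1) sym_imp_balanced[OF M(3)]] H(1) by auto
  then have "M \<subseteq> V \<times> V" by (auto intro: FieldI1 FieldI2)
  moreover have "card (sym_diff M G) \<le> 3 * card (sym_diff N G)"
    using card_sym_diff_triangle[OF M(1) finite(3,1)] M(5)
      card_unreciprocated_le_sym_diff[OF finite(3,1) G(3)] by linarith
  ultimately show ?thesis using that[of M] M(2-4) N(3,4) by simp
qed


section \<open>Undirected graphs as symmetric digraphs\<close>

definition arcs :: "'a set set \<Rightarrow> 'a rel" where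
  "arcs E = {(u, v). {u, v} \<in> E}"

lemma sym_arcs: "sym (arcs E)"
  by (auto simp: arcs_def sym_def insert_commute)

lemma
  assumes "is_graph_on n E"
  shows arcs_subset: "arcs E \<subseteq> {1..n} \<times> {1..n}"
    and irrefl_arcs: "irrefl (arcs E)"
    and outdeg_arcs: "outdeg (arcs E) = deg E"
proof -
  have E: "e \<subseteq> {1..n}" "card e = 2" if "e \<in> E" for e
    using assms that by (auto simp: is_graph_on_def)
  show "arcs E \<subseteq> {1..n} \<times> {1..n}" using E(1) by (fastforce simp: arcs_def)
  show "irrefl (arcs E)" using E(2) by (fastforce simp: arcs_def irrefl_def)
  have "bij_betw (\<lambda>v. {i, v}) (arcs E `` {i}) {e\<in>E. i \<in> e}" for i
    unfolding bij_betw_def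
  proof
    show "inj_on (\<lambda>v. {i, v}) (arcs E `` {i})" by (auto simp: inj_on_def doubleton_eq_iff)
    have "\<exists>v. e = {i, v}" if "e \<in> E" "i \<in> e" for e
      using E(2)[OF that(1)] that(2) by (auto simp: card_2_iff)
    then show "(\<lambda>v. {i, v}) ` (arcs E `` {i}) = {e\<in>E. i \<in> e}"
      by (fastforce simp: arcs_def)
  qed
  then show "outdeg (arcs E) = deg E"
    unfolding outdeg_def deg_def by (intro ext bij_betw_same_card)
qed

lemma sym_digraph_eq_arcs:
  assumes "M \<subseteq> {1..n} \<times> {1..n}" "irrefl M" "sym M"
  obtains E where "is_graph_on n E" "arcs E = M"
proof
  let ?E = "(\<lambda>(u, v). {u, v}) ` M"
  show "is_graph_on n ?E"
    using assms(1,2) unfolding is_graph_on_def irrefl_def by (fastforce simp: card_2_iff)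
  show "arcs ?E = M"
    using assms(3) by (auto simp: arcs_def image_iff doubleton_eq_iff dest: symD)
qed

lemma card_sym_diff_le_arcs:
  assumes "is_graph_on n E" "is_graph_on n E'"
  shows "card (sym_diff E' E) \<le> card (sym_diff (arcs E') (arcs E))"
proof (rule surj_card_le)
  show "finite (sym_diff (arcs E') (arcs E))"
    using finite_subset[OF arcs_subset[OF assms(1)]] finite_subset[OF arcs_subset[OF assms(2)]]
    by simp
  show "sym_diff E' E \<subseteq> (\<lambda>(u, v). {u, v}) ` sym_diff (arcs E') (arcs E)"
  proof
    fix e assume e: "e \<in> sym_diff E' E"
    then have "card e = 2" using assms by (auto simp: is_graph_on_def)
    then obtain u v where "e = {u, v}" by (auto simp: card_2_iff)
    with e show "e \<in> (\<lambda>(u, v). {u, v}) ` sym_diff (arcs E') (arcs E)"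
      by (intro image_eqI[of _ _ "(u, v)"]) (auto simp: arcs_def)
  qed
qed

lemma ex_near_graph:
  fixes t :: real
  assumes E: "is_graph_on n E" and H: "is_graph_on n H" and t: "t \<ge> 1"
    and deviation: "(\<Sum>i=1..n. \<bar>real (deg E i) - real (deg H i)\<bar>) \<le> t\<^sup>2"
  obtains E' where "is_graph_on n E'" "deg E' = deg H"
    "real (card (sym_diff E' E)) \<le> 21 * real n * t"
proof -
  have "(\<Sum>i=1..n. \<bar>real (outdeg (arcs E) i) - real (outdeg (arcs H) i)\<bar>) \<le> t\<^sup>2"
    using deviation by (simp add: outdeg_arcs[OF E] outdeg_arcs[OF H])
  then obtain M where M: "M \<subseteq> {1..n} \<times> {1..n}" "irrefl M" "sym M" "outdeg M = outdeg (arcs H)"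
      "real (card (sym_diff M (arcs E))) \<le> 21 * real (card {1..n}) * t"
    using ex_near_sym_digraph[OF finite_atLeastAtMost arcs_subset[OF E] irrefl_arcs[OF E] sym_arcs
        arcs_subset[OF H] irrefl_arcs[OF H] sym_arcs t] by blast
  obtain E' where E': "is_graph_on n E'" "arcs E' = M"
    using sym_digraph_eq_arcs[OF M(1-3)] .
  have "deg E' = deg H" using outdeg_arcs[OF E'(1)] outdeg_arcs[OF H] E'(2) M(4) by simp
  moreover have "card (sym_diff E' E) \<le> card (sym_diff M (arcs E))"
    using card_sym_diff_le_arcs[OF E E'(1)] E'(2) by simp
  ultimately show ?thesis using that[OF E'(1)] M(5) by simp
qed

lemma one_le_sqrt_mult:
  fixes \<delta> N :: real
  assumes "\<delta> > 0" "N \<ge> 1" "N \<ge> 1 / \<delta>\<^sup>2"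
  shows "sqrt \<delta> * N \<ge> 1"
proof (cases "\<delta> \<ge> 1")
  case True
  then show ?thesis using mult_mono[of 1 "sqrt \<delta>" 1 N] assms(2) by simp
next
  case False
  then have "(\<delta>\<^sup>2)\<^sup>2 \<le> \<delta>"
    using power_decreasing[of 1 4 \<delta>] assms(1) by (simp flip: power_mult)
  then have "\<delta>\<^sup>2 \<le> sqrt \<delta>" by (rule real_le_rsqrt)
  then have "\<delta>\<^sup>2 * N \<le> sqrt \<delta> * N" using assms(2) by (intro mult_right_mono) auto
  moreover have "1 \<le> \<delta>\<^sup>2 * N" using assms(1,3) by (simp add: field_simps)
  ultimately show ?thesis by linarith
qed

theorem theorem1p1:
  "\<exists>C::real. C > 0 \<and>
     (\<forall>(\<delta>::real) (n::nat) (E::nat set set) (d::nat \<Rightarrow> nat).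
        \<delta> > 0 \<longrightarrow> real n \<ge> 1 / \<delta>\<^sup>2 \<longrightarrow> is_graph_on n E \<longrightarrow> realizable n d \<longrightarrow>
        (\<Sum>i=1..n. \<bar>real (deg E i) - real (d i)\<bar>) \<le> \<delta> * (real n)\<^sup>2 \<longrightarrow>
        (\<exists>E'. is_graph_on n E' \<and>
              real (card ((E' - E) \<union> (E - E'))) \<le> C * sqrt \<delta> * (real n)\<^sup>2 \<and>
              (\<forall>i\<in>{1..n}. deg E' i = d i)))"
proof (intro exI[of _ 21] conjI allI impI)
  fix \<delta> :: real and n :: nat and E :: "nat set set" and d :: "nat \<Rightarrow> nat"
  assume \<delta>: "\<delta> > 0" and n: "real n \<ge> 1 / \<delta>\<^sup>2" and E: "is_graph_on n E" and d: "realizable n d"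
    and deviation: "(\<Sum>i=1..n. \<bar>real (deg E i) - real (d i)\<bar>) \<le> \<delta> * (real n)\<^sup>2"
  define t where "t = sqrt \<delta> * real n"
  obtain H where H: "is_graph_on n H" "\<forall>i\<in>{1..n}. deg H i = d i"
    using d by (auto simp: realizable_def)
  have "0 < 1 / \<delta>\<^sup>2" using \<delta> by simp
  with n have "real n > 0" by linarith
  then have "real n \<ge> 1" by simp
  then have t: "t \<ge> 1" unfolding t_def using \<delta> n by (intro one_le_sqrt_mult)
  have "(\<Sum>i=1..n. \<bar>real (deg E i) - real (deg H i)\<bar>) \<le> t\<^sup>2"
    using deviation H(2) \<delta> by (simp add: t_def power_mult_distrib)
  then obtain E' where E': "is_graph_on n E'" "deg E' = deg H"
      "real (card (sym_diff E' E)) \<le> 21 * real n * t"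
    using ex_near_graph[OF E H(1) t] by blast
  then show "\<exists>E'. is_graph_on n E' \<and>
      real (card (sym_diff E' E)) \<le> 21 * sqrt \<delta> * (real n)\<^sup>2 \<and> (\<forall>i\<in>{1..n}. deg E' i = d i)"
    using H(2) by (intro exI[of _ E']) (simp add: t_def power2_eq_square mult_ac)
qed simp

end
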